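(* Let $m\ge 1$ and let $\nu_1,\ldots,\nu_m,l_1,\ldots,l_m$ be positive integers with $1\le \nu_j\le l_j$ for $j=1,\ldots,m$; put $M:=\nu_1+\ldots+\nu_m$ and $L:=l_1+\ldots+l_m$ (so $M\le L$). Let $a_1,\ldots,a_m\in\mathbb{Z}$ and $\overline{a}=(a_1,\ldots,a_m)^T$. Let $\mathcal{V}(\overline{a})$ be the $M\times(L+1)$ integer matrix whose rows are indexed by the pairs $(j,i)$ with $j=1,\ldots,m$ and $i=1,\ldots,\nu_j$ (ordered lexicographically), whose columns are indexed by $h=0,1,\ldots,L$, and whose entry in row $(j,i)$ and column $h$ is $\binom{L+i}{h}a_j^{L-h}$. Let $D(\overline{a})$ be the greatest common divisor of all the $M\times M$ minors of $\mathcal{V}(\overline{a})$. Then, in $\mathbb{Z}$, $$ \left(\prod_{1\le j\le m} a_j^{\binom{\nu_j}{2}}\right)\prod_{1\le i<j\le m}(a_i-a_j)^{\min\{\nu_i^2,\,\nu_j^2\}}\ \Big|\ D(\overline{a}). $$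
   Context: Here $x^0=1$ for every integer $x$ (including $0$), and $\binom{1}{2}=0$. The greatest common divisor of a family of integers that are all zero is $0$. *)

theory Defs
  imports
    "HOL-Computational_Algebra.Computational_Algebra"
    "Jordan_Normal_Form.Determinant"
    "Jordan_Normal_Form.DL_Submatrix"
begin

definition minors :: "nat \<Rightarrow> 'a :: comm_ring_1 mat \<Rightarrow> 'a set" where
  "minors k A = {det (submatrix A I J) | I J.
     I \<subseteq> {..<dim_row A} \<and> J \<subseteq> {..<dim_col A} \<and> card I = k \<and> card J = k}"

text \<open>The families \<open>\<nu>\<close>, \<open>l\<close> and \<open>a\<close> are functions of which only the values at \<open>1, \<dots>, m\<close> matter.\<close>

definition row_indices :: "nat \<Rightarrow> (nat \<Rightarrow> nat) \<Rightarrow> (nat \<times> nat) list" where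
  "row_indices m \<nu> = [(j, i). j \<leftarrow> [1..<m+1], i \<leftarrow> [1..<\<nu> j + 1]]"

text \<open>
  Matrix positions count from 0, so row \<open>r\<close> belongs to the entry at position \<open>r\<close> of the
  lexicographically ordered list of pairs \<open>(j, i)\<close>. The convention \<open>0 ^ 0 = 1\<close> and the value
  \<open>1 choose 2 = 0\<close> are those of the library.
\<close>

definition V_mat :: "nat \<Rightarrow> (nat \<Rightarrow> nat) \<Rightarrow> (nat \<Rightarrow> nat) \<Rightarrow> (nat \<Rightarrow> int) \<Rightarrow> int mat" where
  "V_mat m \<nu> l a =
     (let M = (\<Sum>j=1..m. \<nu> j); L = (\<Sum>j=1..m. l j)
      in mat M (L + 1) (\<lambda>(r, h).
           case row_indices m \<nu> ! r of (j, i) \<Rightarrow> int ((L + i) choose h) * a j ^ (L - h)))"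

definition D_gcd :: "nat \<Rightarrow> (nat \<Rightarrow> nat) \<Rightarrow> (nat \<Rightarrow> nat) \<Rightarrow> (nat \<Rightarrow> int) \<Rightarrow> int" where
  "D_gcd m \<nu> l a = Gcd (minors (\<Sum>j=1..m. \<nu> j) (V_mat m \<nu> l a))"

lemma set_row_indices: "set (row_indices m \<nu>) = (SIGMA j:{1..m}. {1..\<nu> j})"
  unfolding row_indices_def set_concat set_map image_image set_upt
  by (fastforce simp: image_iff)

lemma length_row_indices: "length (row_indices m \<nu>) = (\<Sum>j=1..m. \<nu> j)"
  by (induction m) (simp_all add: row_indices_def)

end

theory Submission
  imports Defs
begin

text \<open>
  Over a unique factorization domain in which the \<open>a\<^sub>j\<close> and their differences are pairwise coprime,
  it suffices to treat each factor separately. In the Leibniz formula for a minor, the \<open>\<nu>\<^sub>j\<close> rows of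
  block \<open>j\<close> contribute \<open>a\<^sub>j\<close> with distinct exponents \<open>L - h\<close>, hence at least \<open>0 + \<dots> + (\<nu>\<^sub>j - 1)\<close> times.
  For \<open>\<delta> = a\<^sub>i - a\<^sub>j\<close>, multiply row \<open>(j, k)\<close> by \<open>a\<^sub>j\<^sup>k\<close>; the rows become coefficient vectors
  \<open>G\<^sub>p(x)\<close> of \<open>(x + z)\<^sup>p\<close> for \<open>p = L + 1, \<dots>\<close>, and \<open>G\<^sub>p(x + \<delta>)\<close> is the sum of
  \<open>(p choose q) \<delta>\<^sup>p\<^sup>-\<^sup>q G\<^sub>q(x)\<close>. Expanding \<open>n\<close> rows of block \<open>i\<close> in this way, only distinct \<open>q \<le> L\<close> survive
  next to \<open>G\<^sub>L\<^sub>+\<^sub>1(x), \<dots>, G\<^sub>L\<^sub>+\<^sub>n(x)\<close> from block \<open>j\<close>, which costs at least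
  \<open>(1 + \<dots> + n) + (0 + \<dots> + (n - 1)) = n\<^sup>2\<close> factors \<open>\<delta>\<close>.
  Arbitrary integers are reached by specializing suitable elements of \<open>\<int>[t][s]\<close>.
\<close>

section \<open>Powers of a ring element dividing a determinant\<close>

text \<open>Distinct naturals sum to at least \<open>0 + ... + (card S - 1)\<close>. This bounds the
  exponents collected from distinct columns or distinct row indices.\<close>

lemma choose_two_le_sum:
  assumes "finite S" "inj_on f S"
  shows "card S choose 2 \<le> sum f S"
proof -
  have "card S choose 2 = \<Sum> {0..<card (f ` S)}"
    by (simp add: card_image assms Sum_Ico_nat choose_two)
  also have "\<dots> \<le> \<Sum> (f ` S)"
    by (rule card_sum_le_nat_sum)
  also have "\<dots> = sum f S"
    by (simp add: sum.reindex assms)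
  finally show ?thesis .
qed

lemma power_choose_two_dvd_det:
  fixes A :: "'a :: comm_ring_1 mat"
  assumes A: "A \<in> carrier_mat n n" and K: "K \<subseteq> {0..<n}" and s: "inj_on s {0..<n}"
    and dvd: "\<And>r c. r \<in> K \<Longrightarrow> c < n \<Longrightarrow> x ^ s c dvd A $$ (r, c)"
  shows "x ^ (card K choose 2) dvd det A"
  unfolding det_def'[OF A]
proof (intro dvd_sum dvd_mult)
  fix p assume "p \<in> {p. p permutes {0..<n}}"
  then have p: "p permutes {0..<n}" by simp
  have finK: "finite K" using K finite_subset by blast
  have pK: "p r < n" if "r \<in> K" for r
    using p K that permutes_in_image[OF p, of r] by auto
  have "inj_on (s \<circ> p) K"
  proof (rule comp_inj_on)
    show "inj_on p K" using permutes_inj[OF p] by (rule inj_on_subset) simp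
    show "inj_on s (p ` K)" using s by (rule inj_on_subset) (use pK in auto)
  qed
  then have "card K choose 2 \<le> sum (s \<circ> p) K"
    using finK by (rule choose_two_le_sum[rotated])
  then have "x ^ (card K choose 2) dvd x ^ sum (s \<circ> p) K"
    by (rule le_imp_power_dvd)
  also have "\<dots> = (\<Prod>r\<in>K. x ^ s (p r))"
    by (simp add: power_sum)
  also have "\<dots> dvd (\<Prod>r\<in>K. A $$ (r, p r))"
    by (intro prod_dvd_prod dvd pK)
  also have "\<dots> dvd (\<Prod>r = 0..<n. A $$ (r, p r))"
    using K by (intro prod_dvd_prod_subset) auto
  finally show "x ^ (card K choose 2) dvd (\<Prod>r = 0..<n. A $$ (r, p r))" .
qed

text \<open>In each Leibniz term exactly one factor comes from row \<open>r\<close>, so every term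
  is linear in that row.\<close>

lemma det_row_sum:
  fixes B :: "nat \<Rightarrow> nat \<Rightarrow> 'a :: comm_ring_1"
  assumes "r < n"
  shows "det (mat n n (\<lambda>(i, c). if i = r then \<Sum>p\<in>P. g p * w p c else B i c)) =
    (\<Sum>p\<in>P. g p * det (mat n n (\<lambda>(i, c). if i = r then w p c else B i c)))"
proof -
  have rem: "(\<Prod>i = 0..<n. if i = r then F i else G i) = F r * (\<Prod>i\<in>{0..<n} - {r}. G i)"
    for F G :: "nat \<Rightarrow> 'a"
    using assms by (subst prod.remove[of _ r]) (auto intro!: arg_cong2[of _ _ _ _ "(*)"] prod.cong)
  have leib: "det (mat n n (\<lambda>(i, c). if i = r then F c else B i c)) =
    (\<Sum>\<pi>\<in>{\<pi>. \<pi> permutes {0..<n}}. signof \<pi> * (F (\<pi> r) * (\<Prod>i\<in>{0..<n} - {r}. B i (\<pi> i))))"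
    for F :: "nat \<Rightarrow> 'a"
    unfolding det_def'[OF mat_carrier]
  proof (intro sum.cong refl arg_cong2[of _ _ _ _ "(*)"])
    fix \<pi> assume "\<pi> \<in> {\<pi>. \<pi> permutes {0..<n}}"
    then have "i < n \<Longrightarrow> \<pi> i < n" for i
      using permutes_in_image[of \<pi> "{0..<n}" i] by auto
    then show "(\<Prod>i = 0..<n. mat n n (\<lambda>(i, c). if i = r then F c else B i c) $$ (i, \<pi> i)) =
        F (\<pi> r) * (\<Prod>i\<in>{0..<n} - {r}. B i (\<pi> i))"
      by (subst rem[symmetric]) (auto intro!: prod.cong)
  qed
  show ?thesis
    unfolding leib sum_distrib_left sum_distrib_right
    by (subst sum.swap) (simp add: algebra_simps)
qed

text \<open>Multilinear expansion of all rows in \<open>K\<close> at once: a choice function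
  \<open>f\<close> picks one summand per row, and it suffices that \<open>d\<close> divides every
  resulting term. The factor \<open>e\<close> lets the induction carry the coefficients already
  pulled out of earlier rows.\<close>

lemma dvd_det_expand_rows:
  fixes A :: "'a :: comm_ring_1 mat"
  assumes "finite K" "K \<subseteq> {0..<n}" "A \<in> carrier_mat n n"
    and "\<And>r c. r \<in> K \<Longrightarrow> c < n \<Longrightarrow> A $$ (r, c) = (\<Sum>p\<in>P. g r p * w p c)"
    and "\<And>f. f \<in> K \<rightarrow> P \<Longrightarrow> d dvd e * (\<Prod>r\<in>K. g r (f r)) *
        det (mat n n (\<lambda>(r, c). if r \<in> K then w (f r) c else A $$ (r, c)))"
  shows "d dvd e * det A"
  using assms
proof (induction K arbitrary: A e rule: finite_induct)
  case empty
  have "mat n n (\<lambda>(r, c). A $$ (r, c)) = A"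
    using empty.prems(2) by auto
  then show ?case
    using empty.prems(4)[of undefined] by simp
next
  case (insert r K)
  define B where "B p = mat n n (\<lambda>(i, c). if i = r then w p c else A $$ (i, c))" for p
  have "A = mat n n (\<lambda>(i, c). if i = r then \<Sum>p\<in>P. g r p * w p c else A $$ (i, c))"
    using insert.prems(2,3) by (intro eq_matI) auto
  then have det: "det A = (\<Sum>p\<in>P. g r p * det (B p))"
    unfolding B_def using insert.prems(1) by (subst det_row_sum[symmetric]) auto
  have "d dvd (e * g r p) * det (B p)" if p: "p \<in> P" for p
  proof (rule insert.IH)
    show "B p $$ (i, c) = (\<Sum>p\<in>P. g i p * w p c)" if "i \<in> K" "c < n" for i c
      using that insert.prems(1,3) insert.hyps(2) by (auto simp: B_def)
    fix f assume f: "f \<in> K \<rightarrow> P"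
    have "d dvd e * (\<Prod>i\<in>insert r K. g i ((f(r := p)) i)) *
        det (mat n n (\<lambda>(i, c). if i \<in> insert r K then w ((f(r := p)) i) c else A $$ (i, c)))"
      using f p by (intro insert.prems(4)) auto
    moreover have "(\<Prod>i\<in>insert r K. g i ((f(r := p)) i)) = g r p * (\<Prod>i\<in>K. g i (f i))"
      using insert.hyps by (auto intro!: arg_cong2[of _ _ _ _ "(*)"] prod.cong)
    moreover have "mat n n (\<lambda>(i, c). if i \<in> insert r K then w ((f(r := p)) i) c else A $$ (i, c)) =
        mat n n (\<lambda>(i, c). if i \<in> K then w (f i) c else B p $$ (i, c))"
      using insert.hyps by (intro eq_matI) (auto simp: B_def)
    ultimately show "d dvd e * g r p * (\<Prod>i\<in>K. g i (f i)) *
        det (mat n n (\<lambda>(i, c). if i \<in> K then w (f i) c else B p $$ (i, c)))"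
      by (simp add: mult.assoc)
  qed (use insert.prems in \<open>auto simp: B_def\<close>)
  then show ?case
    unfolding det sum_distrib_left by (intro dvd_sum) (simp add: mult.assoc)
qed

lemma det_eq_rows:
  fixes A :: "'a :: comm_ring_1 mat"
  assumes "A \<in> carrier_mat n n" "i \<noteq> j" "i < n" "j < n"
    and "\<And>c. c < n \<Longrightarrow> A $$ (i, c) = A $$ (j, c)"
  shows "det A = 0"
  using assms by (intro det_identical_rows[of A n i j]) (auto intro!: eq_vecI)

text \<open>Here \<open>w p\<close> plays the vector \<open>G\<^sub>p(x)\<close>: the rows
  \<open>\<sigma> k\<close> contain \<open>G\<^sub>L\<^sub>+\<^sub>k(x)\<close>, while the rows
  \<open>\<rho> k\<close> contain the expansion of
  \<open>G\<^sub>L\<^sub>+\<^sub>k(x + \<delta>)\<close>.\<close>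

lemma power_square_dvd_det:
  fixes A :: "'a :: comm_ring_1 mat" and \<rho> \<sigma> :: "nat \<Rightarrow> nat"
  assumes A: "A \<in> carrier_mat N N"
    and \<rho>: "\<rho> \<in> {1..n} \<rightarrow> {0..<N}" "inj_on \<rho> {1..n}" and \<sigma>: "\<sigma> \<in> {1..n} \<rightarrow> {0..<N}"
    and disj: "\<rho> ` {1..n} \<inter> \<sigma> ` {1..n} = {}"
    and A\<sigma>: "\<And>k c. k \<in> {1..n} \<Longrightarrow> c < N \<Longrightarrow> A $$ (\<sigma> k, c) = w (L + k) c"
    and A\<rho>: "\<And>k c. k \<in> {1..n} \<Longrightarrow> c < N \<Longrightarrow>
      A $$ (\<rho> k, c) = (\<Sum>p\<le>L + k. b k p * \<delta> ^ (L + k - p) * w p c)"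
  shows "\<delta> ^ n\<^sup>2 dvd det A"
proof -
  define K where "K = \<rho> ` {1..n}"
  define \<kappa> where "\<kappa> = the_inv_into {1..n} \<rho>"
  have \<kappa>\<rho>: "\<kappa> (\<rho> k) = k" if "k \<in> {1..n}" for k
    unfolding \<kappa>_def using that \<rho>(2) by (rule the_inv_into_f_f[rotated])
  \<comment> \<open>Coefficients are padded with zeros so that all rows of \<open>K\<close> share
    the index range \<open>{..L + n}\<close>.\<close>
  define g where "g r p = (if p \<le> L + \<kappa> r then b (\<kappa> r) p * \<delta> ^ (L + \<kappa> r - p) else 0)" for r p
  have "\<delta> ^ n\<^sup>2 dvd 1 * det A"
  proof (rule dvd_det_expand_rows[where K = K and P = "{..L + n}" and g = g and w = w])
    show "finite K" "K \<subseteq> {0..<N}" using \<rho>(1) by (auto simp: K_def)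
    show "A $$ (r, c) = (\<Sum>p\<le>L + n. g r p * w p c)" if "r \<in> K" "c < N" for r c
    proof -
      from that obtain k where k: "k \<in> {1..n}" "r = \<rho> k" by (auto simp: K_def)
      have "A $$ (r, c) = (\<Sum>p\<le>L + k. g r p * w p c)"
        using A\<rho>[OF k(1) that(2)] by (simp add: k(2) g_def \<kappa>\<rho>[OF k(1)])
      also have "\<dots> = (\<Sum>p\<le>L + n. g r p * w p c)"
        using k by (intro sum.mono_neutral_left) (auto simp: g_def \<kappa>\<rho>[OF k(1)])
      finally show ?thesis .
    qed
    fix f assume f: "f \<in> K \<rightarrow> {..L + n}"
    define B where "B = mat N N (\<lambda>(r, c). if r \<in> K then w (f r) c else A $$ (r, c))"
    have B: "B \<in> carrier_mat N N" by (simp add: B_def)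
    have "\<delta> ^ n\<^sup>2 dvd (\<Prod>r\<in>K. g r (f r)) * det B"
    \<comment> \<open>If \<open>f\<close> repeats an index, two expanded rows agree; if it picks an
      index above \<open>L\<close>, that row agrees with some row \<open>\<sigma> k'\<close>. Both
      kill the determinant, so only distinct indices up to \<open>L\<close> remain.\<close>
    proof (cases "inj_on (f \<circ> \<rho>) {1..n} \<and> (\<forall>k\<in>{1..n}. f (\<rho> k) \<le> L)")
      case False
      have "det B = 0"
      proof (cases "inj_on (f \<circ> \<rho>) {1..n}")
        case True
        with False obtain k where k: "k \<in> {1..n}" "f (\<rho> k) > L" by force
        define k' where "k' = f (\<rho> k) - L"
        have k': "k' \<in> {1..n}" "f (\<rho> k) = L + k'"
          using k funcset_mem[OF f, of "\<rho> k"] by (auto simp: k'_def K_def)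
        have "\<sigma> k' \<notin> K" using disj k'(1) unfolding K_def by blast
        moreover have "\<rho> k \<in> K" using k(1) by (simp add: K_def)
        moreover have "\<rho> k < N" "\<sigma> k' < N" using k(1) k'(1) \<rho>(1) \<sigma> by (auto simp: Pi_iff)
        ultimately show ?thesis using k'
          by (intro det_eq_rows[OF B, of "\<rho> k" "\<sigma> k'"]) (auto simp: B_def A\<sigma>)
      next
        case False
        then obtain k k' where k: "k \<in> {1..n}" "k' \<in> {1..n}" "k \<noteq> k'" "f (\<rho> k) = f (\<rho> k')"
          by (auto simp: inj_on_def)
        then have "\<rho> k \<in> K" "\<rho> k' \<in> K" "\<rho> k < N" "\<rho> k' < N"
          using \<rho>(1) by (auto simp: K_def Pi_iff)
        moreover have "\<rho> k \<noteq> \<rho> k'" using k inj_onD[OF \<rho>(2)] by blast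
        ultimately show ?thesis using k(4)
          by (intro det_eq_rows[OF B, of "\<rho> k" "\<rho> k'"]) (auto simp: B_def)
      qed
      then show ?thesis by simp
    next
      case True
      then have le: "f (\<rho> k) \<le> L" if "k \<in> {1..n}" for k using that by auto
      have "inj_on (\<lambda>k. L - f (\<rho> k)) {1..n}"
      proof (rule inj_onI)
        fix k k' assume k: "k \<in> {1..n}" "k' \<in> {1..n}" and "L - f (\<rho> k) = L - f (\<rho> k')"
        then have "(f \<circ> \<rho>) k = (f \<circ> \<rho>) k'"
          using le[of k] le[of k'] by simp
        with True k show "k = k'" by (blast dest: inj_onD)
      qed
      then have "n choose 2 \<le> (\<Sum>k=1..n. L - f (\<rho> k))"
        using choose_two_le_sum[of "{1..n}"] by simp
      \<comment> \<open>The exponent of row \<open>\<rho> k\<close> splits as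
        \<open>k + (L - f (\<rho> k))\<close>: the first parts sum to \<open>n (n + 1) / 2\<close>,
        and the second, being distinct, to at least \<open>n (n - 1) / 2\<close>.\<close>
      moreover have "(\<Sum>k=1..n. L + k - f (\<rho> k)) = (\<Sum>k=1..n. k) + (\<Sum>k=1..n. L - f (\<rho> k))"
        unfolding sum.distrib[symmetric] using le by (intro sum.cong) auto
      moreover have "n\<^sup>2 = (\<Sum>k=1..n. k) + (n choose 2)"
        by (induction n) (simp_all add: power2_eq_square numeral_2_eq_2)
      ultimately have "n\<^sup>2 \<le> (\<Sum>k=1..n. L + k - f (\<rho> k))"
        by simp
      then have "\<delta> ^ n\<^sup>2 dvd \<delta> ^ (\<Sum>k=1..n. L + k - f (\<rho> k))"
        by (rule le_imp_power_dvd)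
      also have "\<dots> = (\<Prod>k=1..n. \<delta> ^ (L + k - f (\<rho> k)))"
        by (simp add: power_sum)
      also have "\<dots> dvd (\<Prod>k=1..n. g (\<rho> k) (f (\<rho> k)))"
        using le by (intro prod_dvd_prod) (auto simp: g_def \<kappa>\<rho>)
      also have "\<dots> = (\<Prod>r\<in>K. g r (f r))"
        unfolding K_def prod.reindex[OF \<rho>(2)] by simp
      finally show ?thesis by simp
    qed
    then show "\<delta> ^ n\<^sup>2 dvd 1 * (\<Prod>r\<in>K. g r (f r)) *
        det (mat N N (\<lambda>(r, c). if r \<in> K then w (f r) c else A $$ (r, c)))"
      by (simp add: B_def)
  qed (fact A)
  then show ?thesis by simp
qed

section \<open>The individual factors of a minor\<close>

text \<open>Compare the coefficients of \<open>z^h\<close> in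
  \<open>(u + z)^P = ((u - v) + (v + z))^P\<close>. Where the subtractions in the exponents
  truncate, the binomial coefficients vanish.\<close>

lemma binomial_power_shift:
  fixes u v :: "'a :: comm_ring_1"
  shows "of_nat (P choose h) * u ^ (P - h) =
    (\<Sum>p\<le>P. of_nat (P choose p) * (u - v) ^ (P - p) * (of_nat (p choose h) * v ^ (p - h)))"
proof (cases "h \<le> P")
  case True
  have "(\<Sum>p\<le>P. of_nat (P choose p) * (u - v) ^ (P - p) * (of_nat (p choose h) * v ^ (p - h))) =
      (\<Sum>p\<in>{h..P}. of_nat (P choose p) * (u - v) ^ (P - p) * (of_nat (p choose h) * v ^ (p - h)))"
    by (rule sum.mono_neutral_right) (auto simp: binomial_eq_0)
  also have "\<dots> = (\<Sum>p\<in>{h..P}. of_nat (P choose h) *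
      (of_nat ((P - h) choose (p - h)) * v ^ (p - h) * (u - v) ^ (P - p)))"
  proof (intro sum.cong refl)
    fix p assume "p \<in> {h..P}"
    then have "(of_nat (P choose p) * of_nat (p choose h) :: 'a) =
        of_nat (P choose h) * of_nat ((P - h) choose (p - h))"
      unfolding of_nat_mult[symmetric] by (subst choose_mult) auto
    from arg_cong[OF this, of "\<lambda>x. x * (v ^ (p - h) * (u - v) ^ (P - p))"]
    show "of_nat (P choose p) * (u - v) ^ (P - p) * (of_nat (p choose h) * v ^ (p - h)) =
        of_nat (P choose h) * (of_nat ((P - h) choose (p - h)) * v ^ (p - h) * (u - v) ^ (P - p))"
      by (simp only: mult_ac)
  qed
  also have "\<dots> = of_nat (P choose h) *
      (\<Sum>q\<le>P - h. of_nat ((P - h) choose q) * v ^ q * (u - v) ^ (P - h - q))"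
    unfolding sum_distrib_left[symmetric] using True
    by (intro arg_cong2[of _ _ _ _ "(*)"] refl sum.reindex_bij_witness[of _ "\<lambda>q. q + h" "\<lambda>p. p - h"]) auto
  also have "\<dots> = of_nat (P choose h) * (v + (u - v)) ^ (P - h)"
    by (subst binomial_ring) simp
  finally show ?thesis by simp
next
  case False
  then have "(of_nat (P choose p) * (u - v) ^ (P - p) * (of_nat (p choose h) * v ^ (p - h)) :: 'a) = 0"
    if "p \<le> P" for p
    using that by (simp add: binomial_eq_0)
  then show ?thesis
    using False by (simp add: binomial_eq_0)
qed

lemma det_scale_rows:
  fixes B :: "nat \<Rightarrow> nat \<Rightarrow> 'a :: comm_ring_1"
  shows "det (mat n n (\<lambda>(r, c). s r * B r c)) = (\<Prod>r<n. s r) * det (mat n n (\<lambda>(r, c). B r c))"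
proof -
  have "(\<Prod>i = 0..<n. mat n n (\<lambda>(r, c). s r * B r c) $$ (i, p i)) =
      (\<Prod>r<n. s r) * (\<Prod>i = 0..<n. mat n n (\<lambda>(r, c). B r c) $$ (i, p i))"
    if "p permutes {0..<n}" for p
    using permutes_in_image[OF that]
    by (simp add: lessThan_atLeast0 prod.distrib[symmetric])
  then show ?thesis
    by (subst (1 2) det_def') (auto simp: sum_distrib_left algebra_simps intro!: sum.cong)
qed

text \<open>The columns are selected by a function \<open>\<kappa>\<close>, and the ring is
  arbitrary so that minors can be carried along ring homomorphisms.\<close>

definition V_minor ::
    "nat \<Rightarrow> (nat \<Rightarrow> nat) \<Rightarrow> nat \<Rightarrow> (nat \<Rightarrow> nat) \<Rightarrow> (nat \<Rightarrow> 'a) \<Rightarrow> 'a :: comm_ring_1" where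
  "V_minor m \<nu> L \<kappa> y = (let M = \<Sum>j=1..m. \<nu> j in
     det (mat M M (\<lambda>(r, c). case row_indices m \<nu> ! r of (j, i) \<Rightarrow>
       of_nat ((L + i) choose \<kappa> c) * y j ^ (L - \<kappa> c))))"

lemma nth_row_indices_mem:
  "r < (\<Sum>j=1..m. \<nu> j) \<Longrightarrow> row_indices m \<nu> ! r \<in> (SIGMA j:{1..m}. {1..\<nu> j})"
  using nth_mem[of r "row_indices m \<nu>"] by (simp add: set_row_indices length_row_indices)

lemma row_position:
  "\<exists>pos. \<forall>j\<in>{1..m}. \<forall>i\<in>{1..\<nu> j}.
     pos (j, i) < (\<Sum>j=1..m. \<nu> j) \<and> row_indices m \<nu> ! pos (j, i) = (j, i)"
proof -
  have "\<forall>x\<in>(SIGMA j:{1..m}. {1..\<nu> j}). \<exists>r. r < (\<Sum>j=1..m. \<nu> j) \<and> row_indices m \<nu> ! r = x"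
    unfolding set_row_indices[symmetric] length_row_indices[symmetric] by (simp add: in_set_conv_nth)
  from bchoice[OF this] obtain pos where "\<forall>x\<in>(SIGMA j:{1..m}. {1..\<nu> j}).
      pos x < (\<Sum>j=1..m. \<nu> j) \<and> row_indices m \<nu> ! pos x = x" ..
  then show ?thesis by (intro exI[of _ pos]) blast
qed

lemma power_dvd_V_minor:
  fixes y :: "nat \<Rightarrow> 'a :: comm_ring_1"
  assumes j: "j \<in> {1..m}"
    and \<kappa>: "inj_on \<kappa> {..<\<Sum>j=1..m. \<nu> j}" "\<And>c. c < (\<Sum>j=1..m. \<nu> j) \<Longrightarrow> \<kappa> c \<le> L"
  shows "y j ^ (\<nu> j choose 2) dvd V_minor m \<nu> L \<kappa> y"
proof -
  obtain pos where pos: "\<And>j i. j \<in> {1..m} \<Longrightarrow> i \<in> {1..\<nu> j} \<Longrightarrow>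
      pos (j, i) < (\<Sum>j=1..m. \<nu> j) \<and> row_indices m \<nu> ! pos (j, i) = (j, i)"
    using row_position[of m \<nu>] by blast
  define K where "K = (\<lambda>i. pos (j, i)) ` {1..\<nu> j}"
  have "inj_on (\<lambda>i. pos (j, i)) {1..\<nu> j}"
    by (rule inj_on_inverseI[of _ "\<lambda>r. snd (row_indices m \<nu> ! r)"]) (use pos[OF j] in simp)
  then have "card K = \<nu> j" by (simp add: K_def card_image)
  moreover have "y j ^ (card K choose 2) dvd V_minor m \<nu> L \<kappa> y"
    unfolding V_minor_def Let_def
  proof (rule power_choose_two_dvd_det)
    \<comment> \<open>Truncated subtraction from \<open>L\<close> is injective here because every
      \<open>\<kappa> c\<close> is at most \<open>L\<close>.\<close>
    show "inj_on (\<lambda>c. L - \<kappa> c) {0..<\<Sum>j=1..m. \<nu> j}"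
    proof (rule inj_onI)
      fix c c' assume "c \<in> {0..<\<Sum>j=1..m. \<nu> j}" "c' \<in> {0..<\<Sum>j=1..m. \<nu> j}" "L - \<kappa> c = L - \<kappa> c'"
      then have "\<kappa> c = \<kappa> c'" "c \<in> {..<\<Sum>j=1..m. \<nu> j}" "c' \<in> {..<\<Sum>j=1..m. \<nu> j}"
        using \<kappa>(2)[of c] \<kappa>(2)[of c'] by auto
      then show "c = c'" by (rule inj_onD[OF \<kappa>(1)])
    qed
  qed (use pos[OF j] in \<open>auto simp: K_def\<close>)
  ultimately show ?thesis by simp
qed

text \<open>Scaling row \<open>(j, i)\<close> by \<open>y j ^ i\<close> raises its exponent to
  \<open>L + i - \<kappa> c\<close>, matching the upper index of the binomial coefficient, so that
  the shift formula applies. The scaling factors stay in the conclusion, to be cancelled once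
  coprimality is available.\<close>

lemma diff_power_dvd_V_minor:
  fixes y :: "nat \<Rightarrow> 'a :: comm_ring_1"
  assumes i: "i \<in> {1..m}" and j: "j \<in> {1..m}" and ij: "i \<noteq> j"
    and \<kappa>: "\<And>c. c < (\<Sum>j=1..m. \<nu> j) \<Longrightarrow> \<kappa> c \<le> L"
  shows "(y i - y j) ^ min ((\<nu> i)\<^sup>2) ((\<nu> j)\<^sup>2) dvd
    (\<Prod>r<\<Sum>j=1..m. \<nu> j. case row_indices m \<nu> ! r of (j, i) \<Rightarrow> y j ^ i) * V_minor m \<nu> L \<kappa> y"
proof -
  obtain pos where pos: "\<And>j i. j \<in> {1..m} \<Longrightarrow> i \<in> {1..\<nu> j} \<Longrightarrow>
      pos (j, i) < (\<Sum>j=1..m. \<nu> j) \<and> row_indices m \<nu> ! pos (j, i) = (j, i)"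
    using row_position[of m \<nu>] by blast
  define M where "M = (\<Sum>j=1..m. \<nu> j)"
  define n where "n = min (\<nu> i) (\<nu> j)"
  define A where "A = mat M M (\<lambda>(r, c). case row_indices m \<nu> ! r of (j, i) \<Rightarrow>
      of_nat ((L + i) choose \<kappa> c) * y j ^ (L + i - \<kappa> c))"
  have "L + i - \<kappa> c = i + (L - \<kappa> c)" if "c < M" for i c
    using \<kappa>[of c] that by (simp add: M_def)
  then have "A = mat M M (\<lambda>(r, c). (case row_indices m \<nu> ! r of (j, i) \<Rightarrow> y j ^ i) *
      (case row_indices m \<nu> ! r of (j, i) \<Rightarrow> of_nat ((L + i) choose \<kappa> c) * y j ^ (L - \<kappa> c)))"
    by (intro eq_matI) (auto simp: A_def power_add mult_ac split: prod.splits)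
  then have det: "det A = (\<Prod>r<M. case row_indices m \<nu> ! r of (j, i) \<Rightarrow> y j ^ i) * V_minor m \<nu> L \<kappa> y"
    by (simp add: det_scale_rows V_minor_def M_def)
  have pi: "pos (i, k) < M \<and> row_indices m \<nu> ! pos (i, k) = (i, k)"
    and pj: "pos (j, k) < M \<and> row_indices m \<nu> ! pos (j, k) = (j, k)" if "k \<in> {1..n}" for k
    using that pos[OF i, of k] pos[OF j, of k] by (auto simp: n_def M_def)
  have "(y i - y j) ^ n\<^sup>2 dvd det A"
  proof (rule power_square_dvd_det)
    show "A \<in> carrier_mat M M" by (simp add: A_def)
    show "(\<lambda>k. pos (i, k)) \<in> {1..n} \<rightarrow> {0..<M}" "(\<lambda>k. pos (j, k)) \<in> {1..n} \<rightarrow> {0..<M}"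
      using pi pj by auto
    show "inj_on (\<lambda>k. pos (i, k)) {1..n}"
      by (rule inj_on_inverseI[of _ "\<lambda>r. snd (row_indices m \<nu> ! r)"]) (use pi in simp)
    show "(\<lambda>k. pos (i, k)) ` {1..n} \<inter> (\<lambda>k. pos (j, k)) ` {1..n} = {}"
    proof (rule ccontr)
      assume "(\<lambda>k. pos (i, k)) ` {1..n} \<inter> (\<lambda>k. pos (j, k)) ` {1..n} \<noteq> {}"
      then obtain k k' where "k \<in> {1..n}" "k' \<in> {1..n}" "pos (i, k) = pos (j, k')" by blast
      with pi[of k] pj[of k'] ij show False by simp
    qed
    show "A $$ (pos (j, k), c) = of_nat ((L + k) choose \<kappa> c) * y j ^ (L + k - \<kappa> c)"
      if "k \<in> {1..n}" "c < M" for k c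
      using pj[OF that(1)] that(2) by (simp add: A_def)
    \<comment> \<open>The expansion around \<open>y j\<close> has
      \<open>\<delta> = y i - y j\<close> and uses the same vectors \<open>w p\<close> that form the
      rows of block \<open>j\<close>.\<close>
    show "A $$ (pos (i, k), c) = (\<Sum>p\<le>L + k. of_nat ((L + k) choose p) * (y i - y j) ^ (L + k - p) *
        (of_nat (p choose \<kappa> c) * y j ^ (p - \<kappa> c)))" if "k \<in> {1..n}" "c < M" for k c
    proof -
      have "A $$ (pos (i, k), c) = of_nat ((L + k) choose \<kappa> c) * y i ^ (L + k - \<kappa> c)"
        using pi[OF that(1)] that(2) by (simp add: A_def)
      then show ?thesis by (simp only: binomial_power_shift[of _ _ "y i" "y j"])
    qed
  qed
  moreover have "min ((\<nu> i)\<^sup>2) ((\<nu> j)\<^sup>2) = n\<^sup>2"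
    by (auto simp: n_def min_def power2_nat_le_eq_le)
  ultimately show ?thesis
    by (simp add: det M_def)
qed

section \<open>Combining pairwise coprime factors\<close>

lemma prod_dvd_of_pairwise_coprime:
  fixes F :: "'b \<Rightarrow> 'a :: semiring_gcd"
  assumes "finite A" "\<And>x. x \<in> A \<Longrightarrow> F x dvd d"
    and "\<And>x y. x \<in> A \<Longrightarrow> y \<in> A \<Longrightarrow> x \<noteq> y \<Longrightarrow> coprime (F x) (F y)"
  shows "prod F A dvd d"
  using assms
  by (induction A rule: finite_induct) (auto intro!: divides_mult prod_coprime_right)

text \<open>The auxiliary value \<open>y 0 = 0\<close> makes each \<open>y j\<close> a difference
  \<open>y j - y 0\<close>, so one hypothesis on differences covers all pairs of factors.\<close>

lemma prod_dvd_V_minor: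
  fixes y :: "nat \<Rightarrow> 'a :: factorial_ring_gcd"
  assumes "inj_on \<kappa> {..<\<Sum>j=1..m. \<nu> j}" "\<And>c. c < (\<Sum>j=1..m. \<nu> j) \<Longrightarrow> \<kappa> c \<le> L"
    and y0: "y 0 = 0"
    and coprime: "\<And>i j k l. i \<noteq> j \<Longrightarrow> k \<noteq> l \<Longrightarrow> {i, j} \<noteq> {k, l} \<Longrightarrow> {i, j, k, l} \<subseteq> {0..m} \<Longrightarrow>
      coprime (y i - y j) (y k - y l)"
  shows "(\<Prod>j=1..m. y j ^ (\<nu> j choose 2)) *
         (\<Prod>(i, j)\<in>{(i, j). 1 \<le> i \<and> i < j \<and> j \<le> m}. (y i - y j) ^ min ((\<nu> i)\<^sup>2) ((\<nu> j)\<^sup>2))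
         dvd V_minor m \<nu> L \<kappa> y"
proof -
  define E where "E = {(i, j). 1 \<le> i \<and> i < j \<and> j \<le> m}"
  have "finite E"
    by (rule finite_subset[of _ "{1..m} \<times> {1..m}"]) (auto simp: E_def)
  have cop: "coprime (y i) (y k)" if "i \<in> {1..m}" "k \<in> {1..m}" "i \<noteq> k" for i k
    using coprime[of i 0 k 0] that y0 by (auto simp: doubleton_eq_iff)
  have cop_diff: "coprime (y i - y j) (y k)" if "(i, j) \<in> E" "k \<in> {1..m}" for i j k
    using coprime[of i j k 0] that y0 by (auto simp: doubleton_eq_iff E_def)
  have cop_diff2: "coprime (y i - y j) (y k - y l)" if "(i, j) \<in> E" "(k, l) \<in> E" "(i, j) \<noteq> (k, l)" for i j k l
    using coprime[of i j k l] that by (auto simp: doubleton_eq_iff E_def)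
  have "(y i - y j) ^ min ((\<nu> i)\<^sup>2) ((\<nu> j)\<^sup>2) dvd V_minor m \<nu> L \<kappa> y" if ij: "(i, j) \<in> E" for i j
  proof -
    \<comment> \<open>The row scaling factor is a product of powers of the \<open>y k\<close>, all
      coprime to \<open>y i - y j\<close>, and can therefore be cancelled.\<close>
    have "coprime ((y i - y j) ^ min ((\<nu> i)\<^sup>2) ((\<nu> j)\<^sup>2))
        (\<Prod>r<\<Sum>j=1..m. \<nu> j. case row_indices m \<nu> ! r of (j, i) \<Rightarrow> y j ^ i)"
      using nth_row_indices_mem[of _ \<nu> m]
      by (intro prod_coprime_right)
         (force split: prod.splits intro!: coprime_power_left_iff[THEN iffD2] coprime_power_right_iff[THEN iffD2] cop_diff ij)
    moreover have "i \<in> {1..m}" "j \<in> {1..m}" "i \<noteq> j" using ij by (auto simp: E_def)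
    ultimately show ?thesis
      using diff_power_dvd_V_minor[of i m j \<nu> \<kappa> L y] assms(2) coprime_dvd_mult_right_iff by blast
  qed
  then have "(\<Prod>(i, j)\<in>E. (y i - y j) ^ min ((\<nu> i)\<^sup>2) ((\<nu> j)\<^sup>2)) dvd V_minor m \<nu> L \<kappa> y"
    using \<open>finite E\<close>
    by (intro prod_dvd_of_pairwise_coprime)
       (force intro: cop_diff2)+
  moreover have "(\<Prod>j=1..m. y j ^ (\<nu> j choose 2)) dvd V_minor m \<nu> L \<kappa> y"
    using assms(1,2) cop by (intro prod_dvd_of_pairwise_coprime power_dvd_V_minor) auto
  moreover have "coprime (\<Prod>j=1..m. y j ^ (\<nu> j choose 2))
      (\<Prod>(i, j)\<in>E. (y i - y j) ^ min ((\<nu> i)\<^sup>2) ((\<nu> j)\<^sup>2))"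
    using cop_diff by (intro prod_coprime_right prod_coprime_left)
      (auto simp: coprime_commute)
  ultimately show ?thesis
    unfolding E_def by (intro divides_mult)
qed

section \<open>Specialization from polynomials to arbitrary integers\<close>

lemma (in comm_ring_hom) hom_V_minor:
  "hom (V_minor m \<nu> L \<kappa> y) = V_minor m \<nu> L \<kappa> (\<lambda>j. hom (y j))"
  unfolding V_minor_def Let_def hom_det[symmetric]
  by (rule arg_cong[of _ _ det], intro eq_matI) (auto simp: hom_distribs split: prod.splits)

lemma V_minor_cong:
  assumes "\<And>j. j \<in> {1..m} \<Longrightarrow> y j = z j"
  shows "V_minor m \<nu> L \<kappa> y = V_minor m \<nu> L \<kappa> z"
  unfolding V_minor_def Let_def using assms nth_row_indices_mem[of _ \<nu> m]
  by (intro arg_cong[of _ _ det] eq_matI) (force split: prod.splits)+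

text \<open>A common divisor divides the nonzero constant \<open>b * c' - b' * c\<close>, so it is
  constant itself; a constant divisor of \<open>[:b, c:]\<close> divides both \<open>b\<close> and
  \<open>c\<close>, hence is a unit.\<close>

lemma coprime_linear_polys:
  fixes b c b' c' :: "'a :: {factorial_ring_gcd, semiring_gcd_mult_normalize}"
  assumes "coprime b c" "b * c' \<noteq> b' * c"
  shows "coprime [:b, c:] [:b', c':]"
proof (rule coprimeI)
  fix d assume d: "d dvd [:b, c:]" "d dvd [:b', c':]"
  then have "d dvd Polynomial.smult c' [:b, c:] - Polynomial.smult c [:b', c':]"
    by (intro dvd_diff dvd_smult)
  also have "\<dots> = [:b * c' - b' * c:]"
    by (simp add: algebra_simps)
  finally have "d dvd [:b * c' - b' * c:]" .
  then have "degree d \<le> 0"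
    using assms(2) dvd_imp_degree_le[of d] by fastforce
  then obtain e where e: "d = [:e:]"
    by (metis degree_eq_zeroE le_zero_eq)
  with d(1) have "e dvd b" "e dvd c"
    by (auto simp: const_poly_dvd_iff coeff_pCons dest: spec[of _ 0] spec[of _ 1])
  with assms(1) show "is_unit d"
    by (simp add: e is_unit_const_poly_iff coprime_common_divisor)
qed

text \<open>This gives the primitivity of the differences \<open>y i - y j\<close>. A divisor of a
  nonzero constant is constant, and it must divide the coefficient 1 at degree
  \<open>i\<close>.\<close>

lemma coprime_const_monom_diff:
  fixes a :: int
  assumes "a \<noteq> 0" "i \<noteq> j"
  shows "coprime [:a:] (monom 1 i - monom 1 j)"
proof (rule coprimeI)
  fix d assume d: "d dvd [:a:]" "d dvd monom 1 i - monom (1 :: int) j"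
  then have "degree d \<le> 0"
    using assms(1) dvd_imp_degree_le[of d "[:a:]"] by simp
  then obtain e where e: "d = [:e:]"
    by (metis degree_eq_zeroE le_zero_eq)
  with d(2) have "e dvd coeff (monom 1 i - monom (1 :: int) j) i"
    by (simp only: const_poly_dvd_iff)
  with assms(2) show "is_unit d"
    by (simp add: e is_unit_const_poly_iff)
qed

lemma prod_dvd_V_minor_int:
  fixes a :: "nat \<Rightarrow> int"
  assumes "inj_on \<kappa> {..<\<Sum>j=1..m. \<nu> j}" "\<And>c. c < (\<Sum>j=1..m. \<nu> j) \<Longrightarrow> \<kappa> c \<le> L"
  shows "(\<Prod>j=1..m. a j ^ (\<nu> j choose 2)) *
         (\<Prod>(i, j)\<in>{(i, j). 1 \<le> i \<and> i < j \<and> j \<le> m}. (a i - a j) ^ min ((\<nu> i)\<^sup>2) ((\<nu> j)\<^sup>2))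
         dvd V_minor m \<nu> L \<kappa> a"
proof -
  define b where "b j = (if j = 0 then 0 else a j)" for j :: nat
  define K where "K = 1 + 2 * (\<Sum>j\<le>m. \<bar>b j\<bar>)"
  define \<alpha> where "\<alpha> j = b j + (2 ^ j - 1) * K" for j
  \<comment> \<open>For distinct \<open>\<alpha>\<^sub>j\<close> the differences of the \<open>y\<^sub>j = \<alpha>\<^sub>j + (t\<^sup>j - 1) s\<close> are primitive and not proportional.
    Setting \<open>t = 2\<close>, \<open>s = -K\<close> turns \<open>y\<^sub>j\<close> into \<open>b\<^sub>j\<close>, while a large \<open>K\<close> makes the \<open>\<alpha>\<^sub>j\<close> distinct
    even if the \<open>b\<^sub>j\<close> are not. As \<open>y\<^sub>0 = 0\<close>, the \<open>y\<^sub>j\<close> themselves are among the differences.\<close>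
  define y :: "nat \<Rightarrow> int poly poly" where "y j = [: [:\<alpha> j:], monom 1 j - 1 :]" for j
  define \<phi> :: "int poly poly \<Rightarrow> int" where "\<phi> p = poly (poly p [:- K:]) 2" for p
  have y_diff: "y i - y j = [: [:\<alpha> i - \<alpha> j:], monom 1 i - monom 1 j :]" for i j
    by (simp add: y_def)
  interpret \<phi>: comm_ring_hom \<phi>
    by unfold_locales (simp_all add: \<phi>_def)
  have \<phi>y: "\<phi> (y j) = b j" for j
    by (simp add: \<phi>_def y_def \<alpha>_def poly_monom algebra_simps)
  \<comment> \<open>Equality would make a nonzero multiple of \<open>K\<close> equal to
    \<open>b j - b i\<close>, whose absolute value is at most twice the sum of all
    \<open>\<bar>b j\<bar>\<close> and so below \<open>K\<close>.\<close>
  have \<alpha>_neq: "\<alpha> i \<noteq> \<alpha> j" if "i \<noteq> j" "i \<le> m" "j \<le> m" for i j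
  proof
    assume "\<alpha> i = \<alpha> j"
    then have eq: "(2 ^ i - 2 ^ j) * K = b j - b i"
      by (simp add: \<alpha>_def algebra_simps)
    have "\<bar>b i\<bar> \<le> (\<Sum>j\<le>m. \<bar>b j\<bar>)" "\<bar>b j\<bar> \<le> (\<Sum>j\<le>m. \<bar>b j\<bar>)"
      using that by (intro member_le_sum; simp)+
    then have "\<bar>b j - b i\<bar> < K" by (simp add: K_def)
    moreover have "\<bar>b j - b i\<bar> = \<bar>2 ^ i - 2 ^ j\<bar> * K"
      unfolding eq[symmetric] abs_mult K_def by (simp add: sum_nonneg)
    moreover have "(2 :: int) ^ i \<noteq> 2 ^ j" using that(1) by simp
    then have "\<bar>2 ^ i - 2 ^ j :: int\<bar> \<ge> 1" by linarith
    moreover have "K \<ge> 0" by (simp add: K_def sum_nonneg)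
    ultimately show False
      using mult_right_mono[of 1 "\<bar>2 ^ i - 2 ^ j :: int\<bar>" K] by simp
  qed
  have "coprime (y i - y j) (y k - y l)"
    if "i \<noteq> j" "k \<noteq> l" "{i, j} \<noteq> {k, l}" "{i, j, k, l} \<subseteq> {0..m}" for i j k l
    unfolding y_diff
  proof (rule coprime_linear_polys)
    show "coprime [:\<alpha> i - \<alpha> j:] (monom 1 i - monom 1 j)"
      using that \<alpha>_neq[of i j] by (intro coprime_const_monom_diff) auto
    have "\<alpha> k \<noteq> \<alpha> l" "\<alpha> i \<noteq> \<alpha> j" using that \<alpha>_neq by auto
    \<comment> \<open>Non-proportionality is read off at degree \<open>h\<close>: the left product
      has coefficient 0 there, the right one plus or minus \<open>\<alpha> k - \<alpha> l\<close>,
      which is nonzero.\<close>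
    have "\<exists>h. h \<in> {i, j} \<and> h \<notin> {k, l}"
      using that(1-3) by blast
    then obtain h where "h \<in> {i, j} \<and> h \<notin> {k, l}" ..
    then have "coeff ([:\<alpha> i - \<alpha> j:] * (monom 1 k - monom 1 l)) h \<noteq>
        coeff ([:\<alpha> k - \<alpha> l:] * (monom 1 i - monom 1 j)) h"
      using that \<open>\<alpha> k \<noteq> \<alpha> l\<close> by auto
    then show "[:\<alpha> i - \<alpha> j:] * (monom 1 k - monom 1 l) \<noteq> [:\<alpha> k - \<alpha> l:] * (monom 1 i - monom 1 j)"
      by metis
  qed
  then have "(\<Prod>j=1..m. y j ^ (\<nu> j choose 2)) *
      (\<Prod>(i, j)\<in>{(i, j). 1 \<le> i \<and> i < j \<and> j \<le> m}. (y i - y j) ^ min ((\<nu> i)\<^sup>2) ((\<nu> j)\<^sup>2))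
      dvd V_minor m \<nu> L \<kappa> y"
    using assms by (intro prod_dvd_V_minor) (auto simp: y_def \<alpha>_def b_def)
  then have "\<phi> ((\<Prod>j=1..m. y j ^ (\<nu> j choose 2)) *
      (\<Prod>(i, j)\<in>{(i, j). 1 \<le> i \<and> i < j \<and> j \<le> m}. (y i - y j) ^ min ((\<nu> i)\<^sup>2) ((\<nu> j)\<^sup>2)))
      dvd \<phi> (V_minor m \<nu> L \<kappa> y)"
    by (rule \<phi>.hom_dvd)
  \<comment> \<open>The image of \<open>y\<close> is \<open>b\<close>, which agrees with
    \<open>a\<close> on \<open>{1..m}\<close>; index 0 does not occur in the minor.\<close>
  also have "\<phi> (V_minor m \<nu> L \<kappa> y) = V_minor m \<nu> L \<kappa> a"
    unfolding \<phi>.hom_V_minor \<phi>y by (rule V_minor_cong) (simp add: b_def)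
  also have "\<phi> ((\<Prod>j=1..m. y j ^ (\<nu> j choose 2)) *
      (\<Prod>(i, j)\<in>{(i, j). 1 \<le> i \<and> i < j \<and> j \<le> m}. (y i - y j) ^ min ((\<nu> i)\<^sup>2) ((\<nu> j)\<^sup>2))) =
      (\<Prod>j=1..m. a j ^ (\<nu> j choose 2)) *
      (\<Prod>(i, j)\<in>{(i, j). 1 \<le> i \<and> i < j \<and> j \<le> m}. (a i - a j) ^ min ((\<nu> i)\<^sup>2) ((\<nu> j)\<^sup>2))"
    unfolding \<phi>.hom_mult \<phi>.hom_prod
    by (intro arg_cong2[of _ _ _ _ "(*)"] prod.cong refl)
       (auto simp: \<phi>.hom_power \<phi>.hom_minus \<phi>y b_def)
  finally show ?thesis .
qed

section \<open>From the matrix minors to the gcd\<close>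

text \<open>A maximal minor uses all \<open>M\<close> rows, so \<open>pick I\<close> is the identity
  on row positions; the columns are enumerated by \<open>\<kappa> = pick J\<close>, which is
  strictly increasing on \<open>{..<M}\<close>.\<close>

lemma minors_V_mat:
  assumes "d \<in> minors (\<Sum>j=1..m. \<nu> j) (V_mat m \<nu> l a)"
  obtains \<kappa> where "inj_on \<kappa> {..<\<Sum>j=1..m. \<nu> j}"
    "\<forall>c<\<Sum>j=1..m. \<nu> j. \<kappa> c \<le> (\<Sum>j=1..m. l j)"
    "d = V_minor m \<nu> (\<Sum>j=1..m. l j) \<kappa> a"
proof -
  define M where "M = (\<Sum>j=1..m. \<nu> j)"
  define L where "L = (\<Sum>j=1..m. l j)"
  have dim: "dim_row (V_mat m \<nu> l a) = M" "dim_col (V_mat m \<nu> l a) = L + 1"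
    by (simp_all add: V_mat_def M_def L_def Let_def)
  have V: "V_mat m \<nu> l a = mat M (L + 1) (\<lambda>(r, h).
      case row_indices m \<nu> ! r of (j, i) \<Rightarrow> int ((L + i) choose h) * a j ^ (L - h))"
    by (simp add: V_mat_def M_def L_def Let_def)
  from assms obtain I J where d: "d = det (submatrix (V_mat m \<nu> l a) I J)"
    and I: "I \<subseteq> {..<M}" "card I = M" and J: "J \<subseteq> {..<L + 1}" "card J = M"
    unfolding minors_def dim M_def[symmetric] by blast
  have I_eq: "I = {..<M}" using I by (intro card_subset_eq) auto
  have pickI: "pick I r = r" if "r < M" for r
  proof -
    have "{a \<in> I. a < r} = {..<r}" using that by (auto simp: I_eq)
    then show ?thesis using pick_card_in_set[of r I] that by (simp add: I_eq)
  qed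
  have J_less: "pick J c \<le> L" if "c < M" for c
    using pick_in_set_le[of c J] that J by auto
  have "inj_on (pick J) {..<M}"
    using J(2) by (intro linorder_inj_onI) (auto simp: dest: pick_mono_le[of _ J])
  moreover have "submatrix (V_mat m \<nu> l a) I J = mat M M (\<lambda>(r, c).
      case row_indices m \<nu> ! r of (j, i) \<Rightarrow> int ((L + i) choose pick J c) * a j ^ (L - pick J c))"
  proof -
    have "{i. i < M \<and> i \<in> I} = I" "{j. j < L + 1 \<and> j \<in> J} = J" using I J by auto
    then show ?thesis
      unfolding submatrix_def dim using I J J_less
      by (intro eq_matI) (auto simp: pickI V less_Suc_eq_le)
  qed
  ultimately show thesis
    using that[of "pick J"] J_less by (simp add: d V_minor_def M_def L_def Let_def)
qed

theorem theorem2p1: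
  fixes m :: nat and \<nu> l :: "nat \<Rightarrow> nat" and a :: "nat \<Rightarrow> int"
  assumes "m \<ge> 1"
    and "\<And>j. 1 \<le> j \<Longrightarrow> j \<le> m \<Longrightarrow> 1 \<le> \<nu> j \<and> \<nu> j \<le> l j"
  shows "(\<Prod>j=1..m. a j ^ (\<nu> j choose 2)) *
         (\<Prod>(i, j)\<in>{(i, j). 1 \<le> i \<and> i < j \<and> j \<le> m}. (a i - a j) ^ min ((\<nu> i)^2) ((\<nu> j)^2))
         dvd D_gcd m \<nu> l a"
  unfolding D_gcd_def
proof (rule Gcd_greatest)
  fix d assume "d \<in> minors (\<Sum>j=1..m. \<nu> j) (V_mat m \<nu> l a)"
  then obtain \<kappa> where \<kappa>: "inj_on \<kappa> {..<\<Sum>j=1..m. \<nu> j}"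
      "\<forall>c<\<Sum>j=1..m. \<nu> j. \<kappa> c \<le> (\<Sum>j=1..m. l j)"
    and d: "d = V_minor m \<nu> (\<Sum>j=1..m. l j) \<kappa> a"
    by (rule minors_V_mat)
  show "(\<Prod>j=1..m. a j ^ (\<nu> j choose 2)) *
      (\<Prod>(i, j)\<in>{(i, j). 1 \<le> i \<and> i < j \<and> j \<le> m}. (a i - a j) ^ min ((\<nu> i)^2) ((\<nu> j)^2)) dvd d"
    unfolding d using \<kappa> by (intro prod_dvd_V_minor_int) simp_all
qed

end
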